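(* Let $G$ be a group and $\{K_\lambda\}_{\lambda\in\Lambda}$ the set of all non-trivial subgroups of $G$. Define a map $\eta$ from $G$ to $\Sigma(\mathcal K_1(G))$ by $\eta(a)=\{K_\lambda a\}_{\lambda\in\Lambda}$. Then $\eta$ is a group homomorphism, and $\ker\eta=\bigcap_{\lambda\in\Lambda}K_\lambda$.
   Context: For $K\le G$, $g\in G$ write $K^g=g^{-1}Kg$. $\mathcal K_1(G)$ is the set of all right cosets $Ha$ of all non-trivial subgroups $H$ of $G$ with operation $Ha*Kb=\langle H,K^{a^{-1}}\rangle ab$; it is an inverse semigroup whose idempotents are the non-trivial subgroups of $G$, with natural partial order $Ha\le_n Kb\iff Kb\subseteq Ha$. In an inverse semigroup $S$, elements $x,y$ are compatible if $xy^{-1}$ and $x^{-1}y$ are both idempotents. A subset of $S$ is permissible if its elements are pairwise compatible and it is an order ideal (down-set) for the natural partial order. The completion $C(S)$ is the set of all permissible subsets of $S$ under the usual multiplication of subsets; it is an inverse monoid with identity $E(S)$ (the set of idempotents of $S$). $\Sigma(S)$ denotes the group of units of $C(S)$. *)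

theory Defs
  imports "HOL-Algebra.Generated_Groups"
begin

text \<open>
  HOL-Algebra has no structure for semigroups without identity, hence the following record.
  All notions below are meant for inverse semigroups.
\<close>

record 'a sgrp = "'a partial_object" +
  sprod :: "['a, 'a] \<Rightarrow> 'a" (infixl \<open>\<star>\<index>\<close> 70)

definition idempotents :: "('a, 'm) sgrp_scheme \<Rightarrow> 'a set" where
  "idempotents S = {e \<in> carrier S. e \<star>\<^bsub>S\<^esub> e = e}"

definition sinverse :: "('a, 'm) sgrp_scheme \<Rightarrow> 'a \<Rightarrow> 'a" where
  "sinverse S x = (THE y. y \<in> carrier S \<and> x \<star>\<^bsub>S\<^esub> y \<star>\<^bsub>S\<^esub> x = x \<and> y \<star>\<^bsub>S\<^esub> x \<star>\<^bsub>S\<^esub> y = y)"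

definition natural_le :: "('a, 'm) sgrp_scheme \<Rightarrow> 'a \<Rightarrow> 'a \<Rightarrow> bool" where
  "natural_le S x y \<longleftrightarrow> (\<exists>e\<in>idempotents S. x = e \<star>\<^bsub>S\<^esub> y)"

definition compatible :: "('a, 'm) sgrp_scheme \<Rightarrow> 'a \<Rightarrow> 'a \<Rightarrow> bool" where
  "compatible S x y \<longleftrightarrow>
     x \<star>\<^bsub>S\<^esub> sinverse S y \<in> idempotents S \<and> sinverse S x \<star>\<^bsub>S\<^esub> y \<in> idempotents S"

definition permissible :: "('a, 'm) sgrp_scheme \<Rightarrow> 'a set \<Rightarrow> bool" where
  "permissible S A \<longleftrightarrow>
     A \<subseteq> carrier S \<and>
     (\<forall>x\<in>A. \<forall>y\<in>A. compatible S x y) \<and>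
     (\<forall>y\<in>A. \<forall>x\<in>carrier S. natural_le S x y \<longrightarrow> x \<in> A)"

definition completion :: "('a, 'm) sgrp_scheme \<Rightarrow> 'a set monoid" where
  "completion S =
     \<lparr>carrier = {A. permissible S A},
      mult = (\<lambda>A B. {x \<star>\<^bsub>S\<^esub> y |x y. x \<in> A \<and> y \<in> B}),
      one = idempotents S\<rparr>"

definition Sigma_group :: "('a, 'm) sgrp_scheme \<Rightarrow> 'a set monoid" where
  "Sigma_group S = units_of (completion S)"

definition nontrivial_subgroups :: "('a, 'm) monoid_scheme \<Rightarrow> 'a set set" where
  "nontrivial_subgroups G = {H. subgroup H G \<and> H \<noteq> {\<one>\<^bsub>G\<^esub>}}"

definition conj_set :: "('a, 'm) monoid_scheme \<Rightarrow> 'a set \<Rightarrow> 'a \<Rightarrow> 'a set" where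
  "conj_set G K g = {inv\<^bsub>G\<^esub> g \<otimes>\<^bsub>G\<^esub> k \<otimes>\<^bsub>G\<^esub> g |k. k \<in> K}"

text \<open>
  The product is a function of the two cosets as sets; by \<open>coset_prod_eq\<close> below it does
  not depend on the chosen representatives.
\<close>

definition coset_prod :: "('a, 'm) monoid_scheme \<Rightarrow> 'a set \<Rightarrow> 'a set \<Rightarrow> 'a set" where
  "coset_prod G A B =
     (THE C. \<exists>H a K b. subgroup H G \<and> subgroup K G \<and> a \<in> carrier G \<and> b \<in> carrier G \<and>
        A = H #>\<^bsub>G\<^esub> a \<and> B = K #>\<^bsub>G\<^esub> b \<and>
        C = generate G (H \<union> conj_set G K (inv\<^bsub>G\<^esub> a)) #>\<^bsub>G\<^esub> (a \<otimes>\<^bsub>G\<^esub> b))"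

definition K1 :: "('a, 'm) monoid_scheme \<Rightarrow> 'a set sgrp" where
  "K1 G =
     \<lparr>carrier = {H #>\<^bsub>G\<^esub> a |H a. H \<in> nontrivial_subgroups G \<and> a \<in> carrier G},
      sprod = coset_prod G\<rparr>"

definition eta :: "('a, 'm) monoid_scheme \<Rightarrow> 'a \<Rightarrow> 'a set set" where
  "eta G a = {K #>\<^bsub>G\<^esub> a |K. K \<in> nontrivial_subgroups G}"

context group begin

lemma coset_subgroup_unique:
  assumes "subgroup H G" "subgroup H' G" "a \<in> carrier G" "a' \<in> carrier G"
    and eq: "H #> a = H' #> a'"
  shows "H = H'"
proof -
  have H: "H \<subseteq> carrier G" "H' \<subseteq> carrier G" using assms subgroup.subset by auto
  have "a' \<in> H #> a" using eq assms rcos_self by simp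
  then have "H #> a' = H' #> a'" using repr_independence[of a' H a] eq assms by metis
  then have "(H #> a') #> inv a' = (H' #> a') #> inv a'" by simp
  then show ?thesis using H assms(4) by (simp add: coset_mult_assoc)
qed

lemma conj_set_subset: "K \<subseteq> carrier G \<Longrightarrow> a \<in> carrier G \<Longrightarrow> conj_set G K a \<subseteq> carrier G"
  by (auto simp: conj_set_def)

lemma generate_conj_le:
  assumes H: "subgroup H G" and K: "subgroup K G" and a: "a \<in> carrier G" and h: "h \<in> H"
  shows "generate G (H \<union> conj_set G K (inv (h \<otimes> a))) \<subseteq> generate G (H \<union> conj_set G K (inv a))"
proof (rule generate_subgroup_incl)
  note Hs = subgroup.subset[OF H] and Ks = subgroup.subset[OF K]
  let ?X = "H \<union> conj_set G K (inv a)"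
  show sg: "subgroup (generate G ?X) G"
    using Hs Ks a conj_set_subset by (intro generate_is_subgroup) auto
  have hc: "h \<in> carrier G" using h Hs by auto
  have hX: "h \<in> generate G ?X" using h by (auto intro: generate.incl)
  have "inv (inv (h \<otimes> a)) \<otimes> k \<otimes> inv (h \<otimes> a) \<in> generate G ?X" if k: "k \<in> K" for k
  proof -
    have kc: "k \<in> carrier G" using k Ks by auto
    have "inv (inv a) \<otimes> k \<otimes> inv a \<in> generate G ?X"
      using k by (intro generate.incl) (auto simp: conj_set_def)
    then have "h \<otimes> (inv (inv a) \<otimes> k \<otimes> inv a) \<otimes> inv h \<in> generate G ?X"
      using hX sg by (simp add: subgroup.m_closed subgroup.m_inv_closed)
    also have "h \<otimes> (inv (inv a) \<otimes> k \<otimes> inv a) \<otimes> inv h = inv (inv (h \<otimes> a)) \<otimes> k \<otimes> inv (h \<otimes> a)"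
      using hc kc a by (simp add: m_assoc inv_mult_group)
    finally show ?thesis .
  qed
  then show "H \<union> conj_set G K (inv (h \<otimes> a)) \<subseteq> generate G ?X"
    by (auto simp: conj_set_def intro: generate.incl)
qed

lemma coset_prod_repr:
  assumes H: "subgroup H G" and K: "subgroup K G" and a: "a \<in> carrier G" and b: "b \<in> carrier G"
    and h: "h \<in> H" and k: "k \<in> K"
  shows "generate G (H \<union> conj_set G K (inv (h \<otimes> a))) #> (h \<otimes> a \<otimes> (k \<otimes> b)) =
    generate G (H \<union> conj_set G K (inv a)) #> (a \<otimes> b)"
proof -
  note Hs = subgroup.subset[OF H] and Ks = subgroup.subset[OF K]
  have c: "h \<in> carrier G" "k \<in> carrier G" using h k Hs Ks by auto
  let ?L = "generate G (H \<union> conj_set G K (inv a))"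
  have sg: "subgroup ?L G" using Hs Ks a conj_set_subset by (intro generate_is_subgroup) auto
  have "generate G (H \<union> conj_set G K (inv (inv h \<otimes> (h \<otimes> a)))) \<subseteq>
      generate G (H \<union> conj_set G K (inv (h \<otimes> a)))"
    using generate_conj_le[OF H K, of "h \<otimes> a" "inv h"] c a subgroup.m_inv_closed[OF H h] by simp
  moreover have "inv h \<otimes> (h \<otimes> a) = a" using c a by (simp flip: m_assoc)
  ultimately have eq: "generate G (H \<union> conj_set G K (inv (h \<otimes> a))) = ?L"
    using generate_conj_le[OF H K a h] by auto
  have "h \<in> ?L" "inv (inv a) \<otimes> k \<otimes> inv a \<in> ?L"
    using h k by (auto simp: conj_set_def intro!: generate.incl)
  then have "h \<otimes> (a \<otimes> k \<otimes> inv a) \<in> ?L" using sg a by (simp add: subgroup.m_closed)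
  then have "h \<otimes> (a \<otimes> k \<otimes> inv a) \<otimes> (a \<otimes> b) \<in> ?L #> (a \<otimes> b)"
    by (auto simp: r_coset_def)
  moreover have "h \<otimes> (a \<otimes> k \<otimes> inv a) \<otimes> (a \<otimes> b) = h \<otimes> a \<otimes> (k \<otimes> b)"
  proof -
    have "inv a \<otimes> (a \<otimes> b) = b" using a b by (simp flip: m_assoc)
    then show ?thesis using a b c by (simp add: m_assoc)
  qed
  ultimately have "?L #> (a \<otimes> b) = ?L #> (h \<otimes> a \<otimes> (k \<otimes> b))"
    using repr_independence[of "h \<otimes> a \<otimes> (k \<otimes> b)" ?L "a \<otimes> b"] sg a b by (metis m_closed)
  with eq show ?thesis by simp
qed

lemma coset_prod_eq:
  assumes H: "subgroup H G" and K: "subgroup K G" and a: "a \<in> carrier G" and b: "b \<in> carrier G"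
  shows "coset_prod G (H #> a) (K #> b) = generate G (H \<union> conj_set G K (inv a)) #> (a \<otimes> b)"
  unfolding coset_prod_def
proof (rule the_equality)
  fix C
  assume "\<exists>H' a' K' b'. subgroup H' G \<and> subgroup K' G \<and> a' \<in> carrier G \<and> b' \<in> carrier G \<and>
    H #> a = H' #> a' \<and> K #> b = K' #> b' \<and>
    C = generate G (H' \<union> conj_set G K' (inv a')) #> (a' \<otimes> b')"
  then obtain H' a' K' b' where H': "subgroup H' G" and K': "subgroup K' G"
    and a': "a' \<in> carrier G" and b': "b' \<in> carrier G"
    and eq: "H #> a = H' #> a'" "K #> b = K' #> b'"
    and C: "C = generate G (H' \<union> conj_set G K' (inv a')) #> (a' \<otimes> b')"
    by blast
  have HK: "H' = H" "K' = K"
    using coset_subgroup_unique[OF H H' a a' eq(1)] coset_subgroup_unique[OF K K' b b' eq(2)]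
    by simp_all
  have "a' \<in> H #> a" "b' \<in> K #> b" using eq HK a' b' H K rcos_self by simp_all
  then obtain h k where "h \<in> H" "a' = h \<otimes> a" "k \<in> K" "b' = k \<otimes> b"
    by (auto simp: r_coset_def)
  then show "C = generate G (H \<union> conj_set G K (inv a)) #> (a \<otimes> b)"
    using C HK coset_prod_repr[OF H K a b] by simp
next
  show "\<exists>H' a' K' b'. subgroup H' G \<and> subgroup K' G \<and> a' \<in> carrier G \<and> b' \<in> carrier G \<and>
    H #> a = H' #> a' \<and> K #> b = K' #> b' \<and>
    generate G (H \<union> conj_set G K (inv a)) #> (a \<otimes> b) =
      generate G (H' \<union> conj_set G K' (inv a')) #> (a' \<otimes> b')"
    using assms by (intro exI[of _ H] exI[of _ a] exI[of _ K] exI[of _ b]) simp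
qed

lemma generate_join_nontrivial:
  assumes "H \<in> nontrivial_subgroups G" "K \<subseteq> carrier G"
  shows "generate G (H \<union> K) \<in> nontrivial_subgroups G"
proof -
  have H: "subgroup H G" "H \<noteq> {\<one>}" using assms by (auto simp: nontrivial_subgroups_def)
  have "subgroup (generate G (H \<union> K)) G"
    using assms(2) subgroup.subset[OF H(1)] by (intro generate_is_subgroup) auto
  moreover have "H \<subseteq> generate G (H \<union> K)" by (auto intro: generate.incl)
  moreover have "\<one> \<in> H" using H(1) by (rule subgroup.one_closed)
  ultimately show ?thesis using H(2) by (auto simp: nontrivial_subgroups_def)
qed

lemma idempotents_K1: "idempotents (K1 G) = nontrivial_subgroups G"
proof (intro equalityI subsetI)
  fix A assume "A \<in> idempotents (K1 G)"
  then obtain H a where H: "H \<in> nontrivial_subgroups G" and a: "a \<in> carrier G"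
    and A: "A = H #> a" and idem: "coset_prod G A A = A"
    by (auto simp: idempotents_def K1_def)
  have sg: "subgroup H G" using H by (simp add: nontrivial_subgroups_def)
  let ?L = "generate G (H \<union> conj_set G H (inv a))"
  have L: "subgroup ?L G"
    using generate_join_nontrivial[OF H, of "conj_set G H (inv a)"] a
      conj_set_subset[of H "inv a"] subgroup.subset[OF sg]
    by (simp add: nontrivial_subgroups_def)
  have eq: "?L #> (a \<otimes> a) = H #> a" using idem coset_prod_eq[OF sg sg a a] A by simp
  have "a \<otimes> a \<in> ?L #> (a \<otimes> a)" using rcos_self L a by simp
  then have "a \<otimes> a \<in> H #> a" using eq by simp
  then obtain h where h: "h \<in> H" "a \<otimes> a = h \<otimes> a" by (auto simp: r_coset_def)
  then have "a = h" using a subgroup.mem_carrier[OF sg h(1)] by simp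
  then have "A = H" using A h(1) coset_join2[OF a sg] by simp
  then show "A \<in> nontrivial_subgroups G" using H by simp
next
  fix H assume H: "H \<in> nontrivial_subgroups G"
  then have sg: "subgroup H G" by (simp add: nontrivial_subgroups_def)
  have Hs: "H \<subseteq> carrier G" using sg by (rule subgroup.subset)
  have one: "H #> \<one> = H" using Hs by simp
  have "conj_set G H \<one> = H" using Hs by (force simp: conj_set_def)
  moreover have "generate G H = H"
    using generateI[OF sg, of H] by simp
  ultimately have "coset_prod G H H = H" using coset_prod_eq[OF sg sg, of \<one> \<one>] one by simp
  then show "H \<in> idempotents (K1 G)"
    using H one by (force simp: idempotents_def K1_def)
qed

lemma natural_le_K1_iff:
  assumes A: "A \<in> carrier (K1 G)" and B: "B \<in> carrier (K1 G)"
  shows "natural_le (K1 G) A B \<longleftrightarrow> B \<subseteq> A"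
proof -
  obtain H a K b where HK: "H \<in> nontrivial_subgroups G" "K \<in> nontrivial_subgroups G"
    and a: "a \<in> carrier G" and b: "b \<in> carrier G" and AB: "A = H #> a" "B = K #> b"
    using A B by (auto simp: K1_def)
  have sg: "subgroup H G" "subgroup K G" using HK by (auto simp: nontrivial_subgroups_def)
  note Hs = subgroup.subset[OF sg(1)] and Ks = subgroup.subset[OF sg(2)]
  have conj: "conj_set G K \<one> = K" using Ks by (force simp: conj_set_def)
  have prod: "coset_prod G L B = generate G (L \<union> K) #> b" if "subgroup L G" for L
    using coset_prod_eq[OF that sg(2) one_closed b] conj b AB subgroup.subset[OF that] by simp
  show ?thesis
  proof
    assume "natural_le (K1 G) A B"
    then obtain L where L: "L \<in> nontrivial_subgroups G" and "A = coset_prod G L B"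
      by (auto simp: natural_le_def idempotents_K1) (auto simp: K1_def)
    then have "A = generate G (L \<union> K) #> b" using prod by (simp add: nontrivial_subgroups_def)
    then show "B \<subseteq> A" using AB by (auto simp: r_coset_def intro: generate.incl)
  next
    assume sub: "B \<subseteq> A"
    have "b \<in> B" using AB rcos_self[OF b sg(2)] by simp
    then have "b \<in> H #> a" using sub AB by auto
    then have AH: "A = H #> b" using repr_independence[OF _ a sg(1)] AB by simp
    have "K \<subseteq> H"
    proof
      fix k assume k: "k \<in> K"
      then have "k \<otimes> b \<in> H #> b" using sub AB AH by (auto simp: r_coset_def)
      then obtain h where h: "h \<in> H" "k \<otimes> b = h \<otimes> b" by (auto simp: r_coset_def)
      then show "k \<in> H" using k b Hs Ks by (metis right_cancel subsetD)
    qed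
    then have "generate G (H \<union> K) = H"
      using generateI[OF sg(1), of H] by (simp add: Un_absorb2)
    then have "A = coset_prod G H B" using prod[OF sg(1)] AH by simp
    then show "natural_le (K1 G) A B"
      using HK(1) unfolding natural_le_def idempotents_K1 by (auto simp: K1_def)
  qed
qed

end

end

theory Submission
  imports Defs
begin

text \<open>
  The product of permissible sets of an inverse semigroup is permissible because \<open>x e y\<inverse>\<close>
  is idempotent whenever \<open>e\<close> and \<open>x y\<inverse>\<close> are; hence the completion is a monoid.
  The inverse of \<open>Ha\<close> in \<open>K1 G\<close> is \<open>H\<^sup>a a\<inverse>\<close>. Two cosets \<open>Ha\<close>, \<open>Ka\<close> with the same
  representative are compatible since \<open>Ha * K\<^sup>a a\<inverse> = \<langle>H, K\<rangle>\<close>, and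
  \<open>Hab = Ha * H\<^sup>a b\<close> gives \<open>\<eta>(ab) = \<eta>(a) \<eta>(b)\<close>. Finally, \<open>\<eta>(a)\<close> is the identity
  iff every \<open>Ka\<close> is a subgroup, that is, \<open>a \<in> K\<close>.
\<close>

section \<open>Inverse semigroups: idempotents, inverses and compatibility\<close>

text \<open>Commuting idempotents together with regularity are equivalent to the existence of unique
  inverses. Both conditions can be checked directly on cosets, so they serve as the axioms, and
  uniqueness is derived in \<open>inverse_unique\<close>.\<close>

locale inverse_sgrp =
  fixes S :: "('a, 'm) sgrp_scheme" (structure)
  assumes closed [simp]: "\<lbrakk>x \<in> carrier S; y \<in> carrier S\<rbrakk> \<Longrightarrow> x \<star> y \<in> carrier S"
    and assoc: "\<lbrakk>x \<in> carrier S; y \<in> carrier S; z \<in> carrier S\<rbrakk> \<Longrightarrow> x \<star> y \<star> z = x \<star> (y \<star> z)"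
    and idem_commute: "\<lbrakk>e \<in> idempotents S; f \<in> idempotents S\<rbrakk> \<Longrightarrow> e \<star> f = f \<star> e"
    and regular: "x \<in> carrier S \<Longrightarrow> \<exists>y\<in>carrier S. x \<star> y \<star> x = x \<and> y \<star> x \<star> y = y"
begin

lemma idem_carrier: "e \<in> idempotents S \<Longrightarrow> e \<in> carrier S"
  by (simp add: idempotents_def)

lemma idem_closed:
  assumes e: "e \<in> idempotents S" and f: "f \<in> idempotents S"
  shows "e \<star> f \<in> idempotents S"
proof -
  note c = idem_carrier[OF e] idem_carrier[OF f]
  have "e \<star> f \<star> (e \<star> f) = e \<star> (f \<star> e) \<star> f" using c by (simp add: assoc)
  also have "\<dots> = e \<star> (e \<star> f) \<star> f" by (simp add: idem_commute[OF f e])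
  also have "\<dots> = (e \<star> e) \<star> (f \<star> f)" using c by (simp add: assoc)
  finally show ?thesis using c e f by (simp add: idempotents_def)
qed

lemma idem_left:
  assumes "x \<in> carrier S" "y \<in> carrier S" "x \<star> y \<star> x = x"
  shows "x \<star> y \<in> idempotents S"
  using assms by (simp add: idempotents_def flip: assoc)

text \<open>Both inverses equal \<open>y \<star> x \<star> z\<close>: the idempotents
  \<open>x \<star> y\<close> and \<open>x \<star> z\<close> commute, and so do
  \<open>y \<star> x\<close> and \<open>z \<star> x\<close>.\<close>

lemma inverse_unique:
  assumes c: "x \<in> carrier S" "y \<in> carrier S" "z \<in> carrier S"
    and y: "x \<star> y \<star> x = x" "y \<star> x \<star> y = y" and z: "x \<star> z \<star> x = x" "z \<star> x \<star> z = z"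
  shows "y = z"
proof -
  \<comment> \<open>Here \<open>x\<close> inside \<open>y \<star> x \<star> y\<close> is replaced by
    \<open>x \<star> z \<star> x\<close>, which creates the two idempotents to be swapped.\<close>
  have "y = y \<star> ((x \<star> z \<star> x) \<star> y)" using c y z by (simp add: assoc)
  also have "\<dots> = y \<star> ((x \<star> z) \<star> (x \<star> y))" using c by (simp add: assoc)
  also have "\<dots> = y \<star> ((x \<star> y) \<star> (x \<star> z))"
    using idem_commute[OF idem_left[of x z] idem_left[of x y]] c y z by simp
  also have "\<dots> = (y \<star> x \<star> y) \<star> (x \<star> z)" using c by (simp add: assoc)
  finally have 1: "y = y \<star> (x \<star> z)" by (simp add: y)
  have "z = (z \<star> (x \<star> y \<star> x)) \<star> z" using c y z by simp
  also have "\<dots> = ((z \<star> x) \<star> (y \<star> x)) \<star> z" using c by (simp add: assoc)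
  also have "\<dots> = ((y \<star> x) \<star> (z \<star> x)) \<star> z"
    using idem_commute[OF idem_left[of z x] idem_left[of y x]] c y z by simp
  also have "\<dots> = (y \<star> x) \<star> (z \<star> x \<star> z)" using c by (simp add: assoc)
  finally have "z = y \<star> (x \<star> z)" using c by (simp add: z assoc)
  with 1 show ?thesis by simp
qed

text \<open>Uniqueness makes the definite description in \<open>sinverse\<close> well defined, so an
  inverse is identified by checking the two regularity equations.\<close>

lemma sinverse_eqI:
  assumes "x \<in> carrier S" "y \<in> carrier S" "x \<star> y \<star> x = x" "y \<star> x \<star> y = y"
  shows "sinverse S x = y"
  unfolding sinverse_def using assms inverse_unique by (intro the_equality) blast+

lemma sinverse:
  assumes "x \<in> carrier S"
  shows "sinverse S x \<in> carrier S" "x \<star> sinverse S x \<star> x = x"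
    "sinverse S x \<star> x \<star> sinverse S x = sinverse S x"
  using regular[OF assms] sinverse_eqI[OF assms] by force+

lemma sinverse_idem: "e \<in> idempotents S \<Longrightarrow> sinverse S e = e"
  by (intro sinverse_eqI) (auto simp: idempotents_def)

lemma idem_inverse:
  assumes "x \<in> carrier S"
  shows "x \<star> sinverse S x \<in> idempotents S" "sinverse S x \<star> x \<in> idempotents S"
  using assms by (auto intro!: idem_left sinverse)

lemma sinverse_sinverse: "x \<in> carrier S \<Longrightarrow> sinverse S (sinverse S x) = x"
  by (intro sinverse_eqI sinverse)

text \<open>The idempotents \<open>e\<close> and \<open>sinverse S x \<star> x\<close> commute. Read
  from right to left, the equation moves an idempotent from the right of \<open>x\<close> to the
  left, as the conjugate \<open>x \<star> e \<star> sinverse S x\<close>.\<close>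

lemma idem_move:
  assumes x: "x \<in> carrier S" and e: "e \<in> idempotents S"
  shows "x \<star> e \<star> sinverse S x \<star> x = x \<star> e"
proof -
  note c = x idem_carrier[OF e] sinverse(1)[OF x]
  have "x \<star> e \<star> sinverse S x \<star> x = x \<star> (e \<star> (sinverse S x \<star> x))"
    using c by (simp add: assoc)
  also have "\<dots> = x \<star> ((sinverse S x \<star> x) \<star> e)"
    using idem_commute[OF e idem_inverse(2)[OF x]] by simp
  also have "\<dots> = x \<star> sinverse S x \<star> x \<star> e" using c by (simp add: assoc)
  finally show ?thesis by (simp add: sinverse(2)[OF x])
qed

lemma idem_conj:
  assumes x: "x \<in> carrier S" and e: "e \<in> idempotents S"
  shows "x \<star> e \<star> sinverse S x \<in> idempotents S"
proof -
  note c = x idem_carrier[OF e] sinverse(1)[OF x]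
  have "x \<star> e \<star> sinverse S x \<star> (x \<star> e \<star> sinverse S x)
      = x \<star> e \<star> sinverse S x \<star> x \<star> (e \<star> sinverse S x)"
    using c by (simp add: assoc)
  also have "\<dots> = x \<star> (e \<star> e) \<star> sinverse S x"
    unfolding idem_move[OF x e] using c by (simp add: assoc)
  finally show ?thesis using c e by (simp add: idempotents_def)
qed

text \<open>The idempotents \<open>y \<star> ?y\<close> and \<open>?x \<star> x\<close> meet in the
  middle of each product. Swapping them produces \<open>x \<star> ?x \<star> x\<close> and
  \<open>y \<star> ?y \<star> y\<close>, or the same with inverses, which collapse.\<close>

lemma sinverse_mult:
  assumes x: "x \<in> carrier S" and y: "y \<in> carrier S"
  shows "sinverse S (x \<star> y) = sinverse S y \<star> sinverse S x"
proof (rule sinverse_eqI)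
  note c = x y sinverse(1)[OF x] sinverse(1)[OF y]
  let ?x = "sinverse S x" and ?y = "sinverse S y"
  note comm = idem_commute[OF idem_inverse(1)[OF y] idem_inverse(2)[OF x]]
  have "x \<star> y \<star> (?y \<star> ?x) \<star> (x \<star> y) = x \<star> ((y \<star> ?y) \<star> (?x \<star> x)) \<star> y"
    using c by (simp add: assoc)
  also have "\<dots> = (x \<star> ?x \<star> x) \<star> (y \<star> ?y \<star> y)" unfolding comm using c by (simp add: assoc)
  finally show "x \<star> y \<star> (?y \<star> ?x) \<star> (x \<star> y) = x \<star> y" by (simp add: sinverse x y)
  have "?y \<star> ?x \<star> (x \<star> y) \<star> (?y \<star> ?x) = ?y \<star> ((?x \<star> x) \<star> (y \<star> ?y)) \<star> ?x"
    using c by (simp add: assoc)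
  also have "\<dots> = (?y \<star> y \<star> ?y) \<star> (?x \<star> x \<star> ?x)"
    unfolding comm[symmetric] using c by (simp add: assoc)
  finally show "?y \<star> ?x \<star> (x \<star> y) \<star> (?y \<star> ?x) = ?y \<star> ?x" by (simp add: sinverse x y)
qed (use x y sinverse in auto)

text \<open>The element factors as \<open>x \<star> e \<star> sinverse S x\<close> times
  \<open>x \<star> sinverse S y\<close>, a product of two idempotents.\<close>

lemma idem_sandwich:
  assumes x: "x \<in> carrier S" and y: "y \<in> carrier S" and e: "e \<in> idempotents S"
    and xy: "x \<star> sinverse S y \<in> idempotents S"
  shows "x \<star> e \<star> sinverse S y \<in> idempotents S"
proof -
  note c = x y idem_carrier[OF e] sinverse(1)[OF x] sinverse(1)[OF y]
  have "x \<star> e \<star> sinverse S x \<star> (x \<star> sinverse S y)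
      = x \<star> e \<star> sinverse S x \<star> x \<star> sinverse S y"
    using c by (simp add: assoc)
  then have "x \<star> e \<star> sinverse S x \<star> (x \<star> sinverse S y) = x \<star> e \<star> sinverse S y"
    by (simp only: idem_move[OF x e])
  with idem_closed[OF idem_conj[OF x e] xy] show ?thesis by simp
qed

lemma compatible_mult:
  assumes c: "x \<in> carrier S" "y \<in> carrier S" "x' \<in> carrier S" "y' \<in> carrier S"
    and x: "compatible S x x'" and y: "compatible S y y'"
  shows "compatible S (x \<star> y) (x' \<star> y')"
proof -
  note i = c[THEN sinverse(1)]
  have "x \<star> (y \<star> sinverse S y') \<star> sinverse S x' \<in> idempotents S"
    using x y c by (intro idem_sandwich) (auto simp: compatible_def)
  \<comment> \<open>The sandwich lemma is now applied to the inverses of \<open>y\<close> and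
    \<open>y'\<close>, whence the double inverse.\<close>
  moreover have "sinverse S y \<star> (sinverse S x \<star> x') \<star> sinverse S (sinverse S y') \<in> idempotents S"
    using x y c i by (intro idem_sandwich) (auto simp: compatible_def sinverse_sinverse)
  ultimately show ?thesis
    using c i by (simp add: compatible_def sinverse_mult sinverse_sinverse assoc)
qed

section \<open>Permissible sets and the completion monoid\<close>

lemma permissible_idempotents: "permissible S (idempotents S)"
proof -
  have "compatible S e f" if "e \<in> idempotents S" "f \<in> idempotents S" for e f
    using that by (simp add: compatible_def sinverse_idem idem_closed)
  then show ?thesis
    unfolding permissible_def natural_le_def using idem_carrier idem_closed by blast
qed

lemma permissible_carrier: "permissible S A \<Longrightarrow> x \<in> A \<Longrightarrow> x \<in> carrier S"
  by (auto simp: permissible_def)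

lemma permissible_idem_mult:
  assumes A: "permissible S A" and x: "x \<in> A" and e: "e \<in> idempotents S"
  shows "e \<star> x \<in> A"
proof -
  have "e \<star> x \<in> carrier S" using permissible_carrier[OF A x] idem_carrier[OF e] by simp
  moreover have "natural_le S (e \<star> x) x" unfolding natural_le_def using e by blast
  ultimately show ?thesis using A x unfolding permissible_def by blast
qed

text \<open>The order is defined by idempotents acting on the left; \<open>idem_move\<close> turns
  the right factor \<open>e\<close> into a left one.\<close>

lemma permissible_mult_idem:
  assumes A: "permissible S A" and x: "x \<in> A" and e: "e \<in> idempotents S"
  shows "x \<star> e \<in> A"
proof -
  have "x \<in> carrier S" using A x by (rule permissible_carrier)
  from permissible_idem_mult[OF A x idem_conj[OF this e]] idem_move[OF this e]
  show ?thesis by simp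
qed

lemma permissible_mult:
  assumes A: "permissible S A" and B: "permissible S B"
  shows "permissible S {x \<star> y |x y. x \<in> A \<and> y \<in> B}"
  unfolding permissible_def
proof (intro conjI ballI impI)
  note cA = permissible_carrier[OF A] and cB = permissible_carrier[OF B]
  show "{x \<star> y |x y. x \<in> A \<and> y \<in> B} \<subseteq> carrier S" using cA cB by auto
  fix u assume u: "u \<in> {x \<star> y |x y. x \<in> A \<and> y \<in> B}"
  then obtain x y where xy: "u = x \<star> y" "x \<in> A" "y \<in> B" by auto
  show "compatible S u v" if "v \<in> {x \<star> y |x y. x \<in> A \<and> y \<in> B}" for v
  proof -
    from that obtain x' y' where xy': "v = x' \<star> y'" "x' \<in> A" "y' \<in> B" by auto
    have "compatible S x x'" "compatible S y y'" using A B xy xy' by (auto simp: permissible_def)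
    then show ?thesis using xy xy' by (simp add: compatible_mult cA cB)
  qed
  fix v assume "natural_le S v u"
  then obtain e where e: "e \<in> idempotents S" "v = e \<star> u" by (auto simp: natural_le_def)
  \<comment> \<open>The idempotent is absorbed into the first factor, which stays in the down-set
    \<open>A\<close>.\<close>
  then have "v = (e \<star> x) \<star> y" using xy cA cB by (simp add: assoc idem_carrier)
  then show "v \<in> {x \<star> y |x y. x \<in> A \<and> y \<in> B}"
    using permissible_idem_mult[OF A xy(2) e(1)] xy(3) by auto
qed

lemma monoid_completion: "monoid (completion S)"
proof (rule monoidI)
  fix A B assume "A \<in> carrier (completion S)" "B \<in> carrier (completion S)"
  then show "A \<otimes>\<^bsub>completion S\<^esub> B \<in> carrier (completion S)"
    using permissible_mult by (simp add: completion_def)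
next
  show "\<one>\<^bsub>completion S\<^esub> \<in> carrier (completion S)"
    by (simp add: completion_def permissible_idempotents)
next
  fix A B C
  assume *: "A \<in> carrier (completion S)" "B \<in> carrier (completion S)" "C \<in> carrier (completion S)"
  have "A \<subseteq> carrier S" "B \<subseteq> carrier S" "C \<subseteq> carrier S"
    using * by (auto simp: completion_def permissible_def)
  then have "x \<star> y \<star> z = x \<star> (y \<star> z)" if "x \<in> A" "y \<in> B" "z \<in> C" for x y z
    using that by (auto intro: assoc)
  then show "A \<otimes>\<^bsub>completion S\<^esub> B \<otimes>\<^bsub>completion S\<^esub> C = A \<otimes>\<^bsub>completion S\<^esub> (B \<otimes>\<^bsub>completion S\<^esub> C)"
    unfolding completion_def by simp (safe; metis)
next
  fix A assume "A \<in> carrier (completion S)"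
  then have A: "permissible S A" by (simp add: completion_def)
  \<comment> \<open>The witnesses are \<open>x \<star> sinverse S x\<close> and \<open>x\<close>
    itself; on the other side, \<open>x\<close> and \<open>sinverse S x \<star> x\<close>.\<close>
  have "\<exists>e y. x = e \<star> y \<and> e \<in> idempotents S \<and> y \<in> A" if "x \<in> A" for x
    using that permissible_carrier[OF A that] by (metis sinverse(2) idem_inverse(1))
  then show "\<one>\<^bsub>completion S\<^esub> \<otimes>\<^bsub>completion S\<^esub> A = A"
    using permissible_idem_mult[OF A] by (auto simp: completion_def)
  have "\<exists>y e. x = y \<star> e \<and> y \<in> A \<and> e \<in> idempotents S" if "x \<in> A" for x
    using that permissible_carrier[OF A that] by (metis sinverse(1,2) idem_inverse(2) assoc)
  then show "A \<otimes>\<^bsub>completion S\<^esub> \<one>\<^bsub>completion S\<^esub> = A"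
    using permissible_mult_idem[OF A] by (auto simp: completion_def)
qed

end

section \<open>Generated subgroups and conjugation\<close>

context group
begin

lemma nontrivial_subgroupsD:
  assumes "H \<in> nontrivial_subgroups G"
  shows "subgroup H G" "H \<subseteq> carrier G"
proof -
  show "subgroup H G" using assms by (simp add: nontrivial_subgroups_def)
  then show "H \<subseteq> carrier G" by (rule subgroup.subset)
qed

text \<open>Flattens the nested joins that arise when three cosets are multiplied.\<close>

lemma generate_generate_Un:
  assumes "A \<subseteq> carrier G" "B \<subseteq> carrier G"
  shows "generate G (generate G A \<union> B) = generate G (A \<union> B)"
proof
  have "subgroup (generate G (A \<union> B)) G" using assms by (intro generate_is_subgroup) auto
  moreover have "generate G A \<union> B \<subseteq> generate G (A \<union> B)"
    using mono_generate[of A "A \<union> B"] generate.incl[of _ "A \<union> B" G] by blast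
  ultimately show "generate G (generate G A \<union> B) \<subseteq> generate G (A \<union> B)"
    by (intro generate_subgroup_incl)
  show "generate G (A \<union> B) \<subseteq> generate G (generate G A \<union> B)"
    by (intro mono_generate) (auto intro: generate.incl)
qed

lemma generate_subgroup: "subgroup H G \<Longrightarrow> generate G H = H"
  by (rule generateI[symmetric]) auto

lemma conj_set_one: "K \<subseteq> carrier G \<Longrightarrow> conj_set G K \<one> = K"
  by (force simp: conj_set_def)

lemma conj_set_conj_set:
  assumes "K \<subseteq> carrier G" "a \<in> carrier G" "b \<in> carrier G"
  shows "conj_set G (conj_set G K a) b = conj_set G K (a \<otimes> b)"
proof -
  have "inv b \<otimes> (inv a \<otimes> k \<otimes> a) \<otimes> b = inv (a \<otimes> b) \<otimes> k \<otimes> (a \<otimes> b)" if "k \<in> K" for k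
    using assms that by (simp add: subset_iff m_assoc inv_mult_group)
  then show ?thesis unfolding conj_set_def by simp (safe; metis)
qed

lemma conj_set_Un: "conj_set G (A \<union> B) a = conj_set G A a \<union> conj_set G B a"
  by (auto simp: conj_set_def)

lemma conj_set_image: "conj_set G K a = (\<lambda>k. inv a \<otimes> k \<otimes> a) ` K"
  by (auto simp: conj_set_def)

text \<open>Viewing conjugation as an endomorphism makes the general facts on images of subgroups
  and of generated subgroups apply to \<open>conj_set\<close>.\<close>

lemma group_hom_conj:
  assumes "a \<in> carrier G"
  shows "group_hom G G (\<lambda>k. inv a \<otimes> k \<otimes> a)"
proof -
  have "inv a \<otimes> (k \<otimes> l) \<otimes> a = inv a \<otimes> k \<otimes> a \<otimes> (inv a \<otimes> l \<otimes> a)"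
    if "k \<in> carrier G" "l \<in> carrier G" for k l
  proof -
    have "a \<otimes> (inv a \<otimes> (l \<otimes> a)) = l \<otimes> a" using assms that by (simp flip: m_assoc)
    then show ?thesis using assms that by (simp add: m_assoc)
  qed
  then show ?thesis using assms by unfold_locales (auto simp: hom_def)
qed

lemma conj_set_generate:
  assumes "a \<in> carrier G" "K \<subseteq> carrier G"
  shows "conj_set G (generate G K) a = generate G (conj_set G K a)"
  using group_hom.generate_img[OF group_hom_conj[OF assms(1)] assms(2)] by (simp add: conj_set_image)

lemma conj_set_nontrivial:
  assumes H: "H \<in> nontrivial_subgroups G" and a: "a \<in> carrier G"
  shows "conj_set G H a \<in> nontrivial_subgroups G"
proof -
  note H' = nontrivial_subgroupsD[OF H]
  have "subgroup (conj_set G H a) G"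
    using group_hom.subgroup_img_is_subgroup[OF group_hom_conj[OF a] H'(1)]
    by (simp add: conj_set_image)
  moreover have False if "conj_set G H a = {\<one>}"
  proof -
    \<comment> \<open>Conjugating back by \<open>inv a\<close> recovers \<open>H\<close>, so a
      trivial conjugate would force \<open>H\<close> to be trivial.\<close>
    have "H = conj_set G (conj_set G H a) (inv a)"
      using H' a by (simp add: conj_set_conj_set conj_set_one)
    also have "\<dots> = {\<one>}" using that a by (simp add: conj_set_def)
    finally show False using H by (simp add: nontrivial_subgroups_def)
  qed
  ultimately show ?thesis by (auto simp: nontrivial_subgroups_def)
qed

section \<open>The inverse semigroup of cosets of non-trivial subgroups\<close>

lemma K1_mult:
  assumes "H \<in> nontrivial_subgroups G" "K \<in> nontrivial_subgroups G"
    "a \<in> carrier G" "b \<in> carrier G"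
  shows "(H #> a) \<star>\<^bsub>K1 G\<^esub> (K #> b) = generate G (H \<union> conj_set G K (inv a)) #> (a \<otimes> b)"
  using assms coset_prod_eq by (simp add: K1_def nontrivial_subgroupsD)

lemma K1_idem_left:
  assumes K: "K \<in> nontrivial_subgroups G" and b: "b \<in> carrier G"
  shows "K \<star>\<^bsub>K1 G\<^esub> (K #> b) = K #> b"
  using K1_mult[OF K K one_closed b] nontrivial_subgroupsD[OF K] b
  by (simp add: conj_set_one generate_subgroup)

lemma join_conj_nontrivial:
  assumes "H \<in> nontrivial_subgroups G" "K \<in> nontrivial_subgroups G" "a \<in> carrier G"
  shows "generate G (H \<union> conj_set G K a) \<in> nontrivial_subgroups G"
  using assms by (intro generate_join_nontrivial conj_set_subset nontrivial_subgroupsD)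

text \<open>The second coset is the inverse of \<open>K #> a\<close>. In the first product the
  conjugations by \<open>a\<close> and \<open>inv a\<close> cancel; in the second both subgroups are
  conjugated by \<open>a\<close>. Taking \<open>H = K\<close> gives the inverse laws,
  \<open>a = \<one>\<close> the commuting of idempotents, and the general case
  compatibility.\<close>

lemma K1_mult_inverse:
  assumes H: "H \<in> nontrivial_subgroups G" and K: "K \<in> nontrivial_subgroups G"
    and a: "a \<in> carrier G"
  shows "(H #> a) \<star>\<^bsub>K1 G\<^esub> (conj_set G K a #> inv a) = generate G (H \<union> K)"
    and "(conj_set G K a #> inv a) \<star>\<^bsub>K1 G\<^esub> (H #> a) = conj_set G (generate G (K \<union> H)) a"
proof -
  note s = nontrivial_subgroupsD(2)[OF H] nontrivial_subgroupsD(2)[OF K]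
  have g: "generate G X \<subseteq> carrier G" if "X \<subseteq> carrier G" for X
    using that by (rule generate_incl)
  show "(H #> a) \<star>\<^bsub>K1 G\<^esub> (conj_set G K a #> inv a) = generate G (H \<union> K)"
    using H K a s g
    by (simp add: K1_mult conj_set_nontrivial conj_set_conj_set conj_set_one)
  show "(conj_set G K a #> inv a) \<star>\<^bsub>K1 G\<^esub> (H #> a) = conj_set G (generate G (K \<union> H)) a"
    using H K a s g conj_set_subset
    by (simp add: K1_mult conj_set_nontrivial conj_set_generate conj_set_Un)
qed

lemma inverse_sgrp_K1: "inverse_sgrp (K1 G)"
proof
  have carrierE: "\<exists>H a. x = H #> a \<and> H \<in> nontrivial_subgroups G \<and> a \<in> carrier G"
    if "x \<in> carrier (K1 G)" for x
    using that by (auto simp: K1_def)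
  have carrierI: "H #> a \<in> carrier (K1 G)"
    if "H \<in> nontrivial_subgroups G" "a \<in> carrier G" for H a
    using that by (auto simp: K1_def)
  {
    fix x y assume "x \<in> carrier (K1 G)" "y \<in> carrier (K1 G)"
    then show "x \<star>\<^bsub>K1 G\<^esub> y \<in> carrier (K1 G)"
      using carrierE[of x] carrierE[of y] by (auto simp: K1_mult intro!: carrierI join_conj_nontrivial)
  next
    fix x y z assume "x \<in> carrier (K1 G)" "y \<in> carrier (K1 G)" "z \<in> carrier (K1 G)"
    then obtain H a K b L c where x: "x = H #> a" "H \<in> nontrivial_subgroups G" "a \<in> carrier G"
      and y: "y = K #> b" "K \<in> nontrivial_subgroups G" "b \<in> carrier G"
      and z: "z = L #> c" "L \<in> nontrivial_subgroups G" "c \<in> carrier G"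
      using carrierE by metis
    note s = x(2)[THEN nontrivial_subgroupsD(2)] y(2)[THEN nontrivial_subgroupsD(2)]
      z(2)[THEN nontrivial_subgroupsD(2)]
    have cs: "conj_set G K (inv a) \<subseteq> carrier G" "conj_set G L (inv b) \<subseteq> carrier G"
      "conj_set G L (inv b \<otimes> inv a) \<subseteq> carrier G"
      using s x y by (simp_all add: conj_set_subset)
    \<comment> \<open>Both bracketings give the coset of \<open>a \<otimes> b \<otimes> c\<close>
      over the subgroup generated by \<open>?M\<close>. The conjugator of \<open>L\<close> is
      \<open>inv (a \<otimes> b)\<close>, written out.\<close>
    let ?M = "H \<union> (conj_set G K (inv a) \<union> conj_set G L (inv b \<otimes> inv a))"
    have "x \<star>\<^bsub>K1 G\<^esub> y \<star>\<^bsub>K1 G\<^esub> z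
        = generate G (generate G (H \<union> conj_set G K (inv a)) \<union> conj_set G L (inv b \<otimes> inv a))
          #> (a \<otimes> b \<otimes> c)"
      using x y z by (simp add: K1_mult join_conj_nontrivial inv_mult_group)
    also have "\<dots> = generate G ?M #> (a \<otimes> (b \<otimes> c))"
      using s cs x y z by (simp add: generate_generate_Un m_assoc Un_assoc)
    \<comment> \<open>Conjugation by \<open>inv a\<close> distributes over the join of
      \<open>K\<close> and \<open>conj_set G L (inv b)\<close> and composes with the conjugation by
      \<open>inv b\<close>.\<close>
    also have "\<dots> = generate G (H \<union> conj_set G (generate G (K \<union> conj_set G L (inv b))) (inv a))
          #> (a \<otimes> (b \<otimes> c))"
      using s cs x y z generate_generate_Un[of "conj_set G K (inv a) \<union> conj_set G L (inv b \<otimes> inv a)" H]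
      by (simp add: conj_set_generate conj_set_Un conj_set_conj_set Un_commute)
    also have "\<dots> = x \<star>\<^bsub>K1 G\<^esub> (y \<star>\<^bsub>K1 G\<^esub> z)"
      using x y z by (simp add: K1_mult join_conj_nontrivial)
    finally show "x \<star>\<^bsub>K1 G\<^esub> y \<star>\<^bsub>K1 G\<^esub> z = x \<star>\<^bsub>K1 G\<^esub> (y \<star>\<^bsub>K1 G\<^esub> z)" .
  next
    fix e f assume "e \<in> idempotents (K1 G)" "f \<in> idempotents (K1 G)"
    then have ef: "e \<in> nontrivial_subgroups G" "f \<in> nontrivial_subgroups G"
      by (simp_all add: idempotents_K1)
    show "e \<star>\<^bsub>K1 G\<^esub> f = f \<star>\<^bsub>K1 G\<^esub> e"
      using K1_mult_inverse(1)[OF ef one_closed] K1_mult_inverse(1)[OF ef(2,1) one_closed]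
        ef[THEN nontrivial_subgroupsD(2)]
      by (simp add: conj_set_one Un_commute)
  next
    fix x assume "x \<in> carrier (K1 G)"
    then obtain H a where x: "x = H #> a" and H: "H \<in> nontrivial_subgroups G" and a: "a \<in> carrier G"
      using carrierE by blast
    note H' = nontrivial_subgroupsD[OF H]
    let ?y = "conj_set G H a #> inv a"
    \<comment> \<open>The two products are the idempotents \<open>H\<close> and
      \<open>conj_set G H a\<close>, which are left identities for \<open>x\<close> and
      \<open>?y\<close> by \<open>K1_idem_left\<close>.\<close>
    have 1: "x \<star>\<^bsub>K1 G\<^esub> ?y = H"
      using x H H' a by (simp add: K1_mult_inverse generate_subgroup)
    have 2: "?y \<star>\<^bsub>K1 G\<^esub> x = conj_set G H a"
      using x H H' a by (simp add: K1_mult_inverse generate_subgroup)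
    have c: "conj_set G H a \<in> nontrivial_subgroups G" using H a by (rule conj_set_nontrivial)
    show "\<exists>y\<in>carrier (K1 G). x \<star>\<^bsub>K1 G\<^esub> y \<star>\<^bsub>K1 G\<^esub> x = x \<and> y \<star>\<^bsub>K1 G\<^esub> x \<star>\<^bsub>K1 G\<^esub> y = y"
      using 1 2 c H a x K1_idem_left[OF H a] K1_idem_left[OF c] by (intro bexI[of _ ?y]) (auto intro: carrierI)
  }
qed

lemma sinverse_K1:
  assumes H: "H \<in> nontrivial_subgroups G" and a: "a \<in> carrier G"
  shows "sinverse (K1 G) (H #> a) = conj_set G H a #> inv a"
proof -
  interpret S: inverse_sgrp "K1 G" by (rule inverse_sgrp_K1)
  note H' = nontrivial_subgroupsD[OF H]
  have c: "conj_set G H a \<in> nontrivial_subgroups G" using H a by (rule conj_set_nontrivial)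
  show ?thesis
  proof (rule S.sinverse_eqI)
    show "H #> a \<in> carrier (K1 G)" "conj_set G H a #> inv a \<in> carrier (K1 G)"
      using H c a by (auto simp: K1_def)
  qed (use H H' c a K1_idem_left in \<open>simp_all add: K1_mult_inverse generate_subgroup\<close>)
qed

section \<open>The map \<open>eta\<close>: permissibility, multiplicativity and kernel\<close>

lemma permissible_eta:
  assumes a: "a \<in> carrier G"
  shows "permissible (K1 G) (eta G a)"
  unfolding permissible_def
proof (intro conjI ballI impI)
  show "eta G a \<subseteq> carrier (K1 G)" using a by (auto simp: eta_def K1_def)
next
  fix x y assume "x \<in> eta G a" "y \<in> eta G a"
  then obtain H K where H: "H \<in> nontrivial_subgroups G" "x = H #> a"
    and K: "K \<in> nontrivial_subgroups G" "y = K #> a"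
    by (auto simp: eta_def)
  \<comment> \<open>The two products in the definition of compatibility are this join and its
    conjugate by \<open>a\<close>, both idempotents.\<close>
  have "generate G (H \<union> K) \<in> nontrivial_subgroups G"
    using H K by (intro generate_join_nontrivial nontrivial_subgroupsD)
  then show "compatible (K1 G) x y"
    using H K a
    by (simp add: compatible_def sinverse_K1 K1_mult_inverse idempotents_K1 conj_set_nontrivial Un_commute)
next
  fix x y assume "y \<in> eta G a" "natural_le (K1 G) x y"
  then obtain H K where H: "H \<in> nontrivial_subgroups G" and K: "K \<in> nontrivial_subgroups G"
    and x: "x = H \<star>\<^bsub>K1 G\<^esub> (K #> a)"
    by (auto simp: eta_def natural_le_def idempotents_K1)
  \<comment> \<open>The idempotent \<open>H\<close> is the coset \<open>H #> \<one>\<close>, so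
    multiplying by it enlarges the subgroup and keeps the representative \<open>a\<close>.\<close>
  have "x = generate G (H \<union> K) #> a"
    using K1_mult[OF H K one_closed a] x a H K by (simp add: nontrivial_subgroupsD conj_set_one)
  moreover have "generate G (H \<union> K) \<in> nontrivial_subgroups G"
    using H K by (intro generate_join_nontrivial nontrivial_subgroupsD)
  ultimately show "x \<in> eta G a" by (auto simp: eta_def)
qed

lemma eta_one: "eta G \<one> = idempotents (K1 G)"
  unfolding eta_def idempotents_K1 by (force simp: nontrivial_subgroupsD)

lemma eta_mult:
  assumes a: "a \<in> carrier G" and b: "b \<in> carrier G"
  shows "eta G a \<otimes>\<^bsub>completion (K1 G)\<^esub> eta G b = eta G (a \<otimes> b)"
proof (intro equalityI subsetI)
  fix x assume "x \<in> eta G a \<otimes>\<^bsub>completion (K1 G)\<^esub> eta G b"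
  then obtain H K where "H \<in> nontrivial_subgroups G" "K \<in> nontrivial_subgroups G"
    "x = (H #> a) \<star>\<^bsub>K1 G\<^esub> (K #> b)"
    by (auto simp: completion_def eta_def)
  then show "x \<in> eta G (a \<otimes> b)"
    using a b by (auto simp: eta_def K1_mult join_conj_nontrivial)
next
  fix x assume "x \<in> eta G (a \<otimes> b)"
  then obtain H where H: "H \<in> nontrivial_subgroups G" and x: "x = H #> (a \<otimes> b)"
    by (auto simp: eta_def)
  \<comment> \<open>The second subgroup is chosen so that conjugation by \<open>inv a\<close>
    returns it to \<open>H\<close> and the join adds nothing.\<close>
  have "x = (H #> a) \<star>\<^bsub>K1 G\<^esub> (conj_set G H a #> b)"
    using H a b x
    by (simp add: K1_mult conj_set_nontrivial conj_set_conj_set conj_set_one generate_subgroup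
        nontrivial_subgroupsD)
  then show "x \<in> eta G a \<otimes>\<^bsub>completion (K1 G)\<^esub> eta G b"
    using H conj_set_nontrivial[OF H a] by (auto simp: completion_def eta_def)
qed

text \<open>The two-sided inverse is \<open>eta G (inv a)\<close>, since \<open>eta\<close> is
  multiplicative and \<open>eta G \<one>\<close> is the identity of the completion.\<close>

lemma eta_Units:
  assumes a: "a \<in> carrier G"
  shows "eta G a \<in> Units (completion (K1 G))"
proof -
  have "eta G a \<otimes>\<^bsub>completion (K1 G)\<^esub> eta G (inv a) = \<one>\<^bsub>completion (K1 G)\<^esub>"
    "eta G (inv a) \<otimes>\<^bsub>completion (K1 G)\<^esub> eta G a = \<one>\<^bsub>completion (K1 G)\<^esub>"
    using a by (simp_all add: eta_mult eta_one) (simp_all add: completion_def)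
  then show ?thesis
    using a permissible_eta[of a] permissible_eta[of "inv a"]
    by (auto simp: Units_def) (auto simp: completion_def)
qed

lemma eta_eq_idempotents_iff:
  assumes a: "a \<in> carrier G"
  shows "eta G a = idempotents (K1 G) \<longleftrightarrow> (\<forall>K\<in>nontrivial_subgroups G. a \<in> K)"
proof
  assume eq: "eta G a = idempotents (K1 G)"
  show "\<forall>K\<in>nontrivial_subgroups G. a \<in> K"
  proof
    fix K assume K: "K \<in> nontrivial_subgroups G"
    \<comment> \<open>At this point \<open>K #> a\<close> is only known to be some non-trivial
      subgroup. It therefore contains \<open>\<one>\<close>, and this forces it to equal
      \<open>K #> \<one>\<close>.\<close>
    then have "K #> a \<in> nontrivial_subgroups G"
      using eq by (auto simp: eta_def idempotents_K1)
    then have "subgroup (K #> a) G" by (rule nontrivial_subgroupsD)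
    then have "K #> a = K #> \<one>"
      using K a by (intro repr_independence subgroup.one_closed) (auto dest: nontrivial_subgroupsD)
    then have "a \<in> K #> \<one>" using rcos_self[OF a nontrivial_subgroupsD(1)[OF K]] by simp
    then show "a \<in> K" using K by (simp add: nontrivial_subgroupsD)
  qed
next
  assume "\<forall>K\<in>nontrivial_subgroups G. a \<in> K"
  then have "K #> a = K" if "K \<in> nontrivial_subgroups G" for K
    using that a by (intro coset_join2) (auto dest: nontrivial_subgroupsD)
  then show "eta G a = idempotents (K1 G)" by (force simp: eta_def idempotents_K1)
qed

end

text \<open>The intersection with \<open>carrier G\<close> matters for the trivial group: its family
  of non-trivial subgroups is empty, and \<open>\<Inter>\<close> of the empty family is
  \<open>UNIV\<close>.\<close>

theorem lemma4p1:
  fixes G :: "('a, 'm) monoid_scheme"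
  assumes "group G"
  shows "group_hom G (Sigma_group (K1 G)) (eta G) \<and>
    kernel G (Sigma_group (K1 G)) (eta G) = carrier G \<inter> \<Inter> (nontrivial_subgroups G)"
proof
  interpret group G by fact
  have "group (Sigma_group (K1 G))"
    unfolding Sigma_group_def
    by (intro monoid.units_group inverse_sgrp.monoid_completion inverse_sgrp_K1)
  then show "group_hom G (Sigma_group (K1 G)) (eta G)"
    using assms eta_Units eta_mult
    by (simp add: group_hom_def group_hom_axioms_def hom_def Sigma_group_def units_of_def)
  have "\<one>\<^bsub>Sigma_group (K1 G)\<^esub> = idempotents (K1 G)"
    by (simp add: Sigma_group_def units_of_def completion_def)
  then show "kernel G (Sigma_group (K1 G)) (eta G) = carrier G \<inter> \<Inter> (nontrivial_subgroups G)"
    unfolding kernel_def using eta_eq_idempotents_iff by auto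
qed

end
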